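(* For every $g\ge 1$, the sequence $T^g=\big((x^g_n,y^g_n)\big)_{n\ge 0}$ defined recursively by the algorithm described in the context coincides with the $g$-sequence $S^g=\big((a^g_n,b^g_n)\big)_{n\ge0}$ of all 2-Star Nim positions with Sprague-Grundy value $g$; that is, $(x^g_n,y^g_n)=(a^g_n,b^g_n)$ for all $n\ge 0$.
   Context: 2-Star Nim: a position is a pair $(a,b)$ of nonnegative integers, not both $0$ (one token on square $a$ of a first strip and one on square $b$ of a second strip, the two strips sharing their square $0$, which holds at most one token). A move replaces exactly one coordinate by a smaller nonnegative integer, provided the result is not $(0,0)$. A player unable to move loses. $\mathcal{G}(a,b)$ is the Sprague-Grundy value, $\mathcal{G}(p)=\operatorname{mex}\{\mathcal{G}(q): q\text{ reachable from }p\text{ in one move}\}$, where $\operatorname{mex}(S)$ is the least nonnegative integer not in $S$. It is symmetric in $a,b$, and positions are considered up to order, written with $a\le b$. The $g$-sequence: $S^g=\big((a^g_0,b^g_0),(a^g_1,b^g_1),\ldots\big)$ lists all positions $(a,b)$ with $a\le b$ and $\mathcal{G}(a,b)=g$, ordered so that $a^g_i<a^g_j$ whenever $i<j$. The algorithm: $T^0:=S^0=\big((0,1),(2,2),(3,3),(4,4),\ldots\big)$. For $g\ge1$, given the sequences $T^k$ for $k<g$ and the terms $(x^g_i,y^g_i)$ for $i<n$: (1) $x^g_n=\operatorname{mex}\{x^g_i,y^g_i\mid 0\le i<n\}$; (2) $y^g_n=x^g_n+z$, where $z$ is the smallest nonnegative integer such that $(x^g_n,x^g_n+z)$ is a legal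 position (i.e. is not $(0,0)$) and (a) $x^g_n+z\notin\{y^g_l\mid 0\le l<n\}$, and (b) $(x^g_n,x^g_n+z)$ is not a term of $T^k$ for any $k<g$. *)

theory Defs
  imports Main
begin

definition mex :: "nat set \<Rightarrow> nat" where
  "mex S = (LEAST n. n \<notin> S)"

definition legal :: "nat \<times> nat \<Rightarrow> bool" where
  "legal p \<longleftrightarrow> p \<noteq> (0, 0)"

definition options_of :: "nat \<times> nat \<Rightarrow> (nat \<times> nat) set" where
  "options_of p = {q. legal q \<and>
     (fst q < fst p \<and> snd q = snd p \<or> fst q = fst p \<and> snd q < snd p)}"

(* The value at the illegal pair (0, 0) is meaningless; it never enters the
   value of a legal position, because options_of contains legal pairs only. *)
function grundy :: "nat \<times> nat \<Rightarrow> nat" where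
  "grundy p = mex (grundy ` options_of p)"
  by pat_completeness auto
termination
  by (relation "measure (\<lambda>p. fst p + snd p)") (auto simp: options_of_def)

definition positions_of_value :: "nat \<Rightarrow> (nat \<times> nat) set" where
  "positions_of_value g = {(a, b). legal (a, b) \<and> a \<le> b \<and> grundy (a, b) = g}"

definition is_g_sequence :: "nat \<Rightarrow> (nat \<Rightarrow> nat \<times> nat) \<Rightarrow> bool" where
  "is_g_sequence g s \<longleftrightarrow>
     range s = positions_of_value g \<and> (\<forall>i j. i < j \<longrightarrow> fst (s i) < fst (s j))"

(* At most one s satisfies is_g_sequence g s, as a strictly increasing
   enumeration of a set of naturals is unique. That one exists is not built in
   here and has to be established before this definition can be used. *)
definition g_sequence :: "nat \<Rightarrow> nat \<Rightarrow> nat \<times> nat" where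
  "g_sequence g = (THE s. is_g_sequence g s)"

(* The term number n of the sequence T^g. *)
function alg_sequence :: "nat \<Rightarrow> nat \<Rightarrow> nat \<times> nat" where
  "alg_sequence g n =
    (if g = 0 then (if n = 0 then (0, 1) else (n + 1, n + 1))
     else
       let prev = (\<lambda>i. alg_sequence g i) ` {..<n};
           x = mex (fst ` prev \<union> snd ` prev);
           z = (LEAST z. legal (x, x + z) \<and> x + z \<notin> snd ` prev \<and>
                  (\<forall>k<g. (x, x + z) \<notin> range (\<lambda>m. alg_sequence k m)))
       in (x, x + z))"
  by pat_completeness auto
termination
  by (relation "less_than <*lex*> less_than") auto

declare grundy.simps [simp del] alg_sequence.simps [simp del]

end

theory Submission
  imports Defs "HOL-Library.Infinite_Set"
begin

text \<open>
  Every value g occurs exactly once in every row x of the table of Sprague-Grundy values, so the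
  positions of value g are the graph of an involution f of the naturals, and the g-sequence lists
  the pairs (x, f x) with x at most f x. Its next first entry is the least number not yet covered,
  because every number belongs to exactly one pair. Its second entry is found by the search of the
  algorithm: if y lies between x and f x, then either (x, y) has a value below g, or it has an
  option of value g; that option is not in row x, so it is (x', y) with x' less than x, and y has
  already been used as a second entry.
\<close>

section \<open>Minimal excluded values, options and symmetry\<close>

lemma mex_notin:
  assumes "finite S"
  shows "mex S \<notin> S"
  unfolding mex_def
  by (rule LeastI_ex) (use assms ex_new_if_finite infinite_UNIV_nat in blast)

lemma mem_if_less_mex: "n < mex S \<Longrightarrow> n \<in> S"
  unfolding mex_def using not_less_Least by blast

lemma mex_eqI:
  assumes "n \<notin> S" and "\<And>m. m < n \<Longrightarrow> m \<in> S"
  shows "mex S = n"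
  unfolding mex_def by (rule Least_equality) (use assms not_less in blast)+

lemma finite_options_of: "finite (options_of p)"
  by (rule finite_subset[of _ "{..fst p} \<times> {..snd p}"]) (auto simp: options_of_def)

lemma grundy_option_neq:
  assumes "q \<in> options_of p"
  shows "grundy q \<noteq> grundy p"
proof -
  have "grundy p \<notin> grundy ` options_of p"
    by (subst grundy.simps) (simp add: mex_notin finite_options_of)
  then show ?thesis using assms by (metis image_eqI)
qed

lemma ex_option_of_less_grundy:
  assumes "g < grundy p"
  obtains q where "q \<in> options_of p" and "grundy q = g"
proof -
  have "g \<in> grundy ` options_of p"
    using assms by (subst (asm) grundy.simps) (rule mem_if_less_mex)
  then show thesis using that by blast
qed

text \<open>Swapping coordinates matches the options of the two positions, and options have a
  smaller coordinate sum.\<close>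

lemma grundy_commute: "grundy (a, b) = grundy (b, a)"
proof (induction "a + b" arbitrary: a b rule: less_induct)
  case less
  \<comment> \<open>Stated for arbitrary \<open>a\<close> and \<open>b\<close>, with the induction
    hypothesis as a premise, so that it serves for both inclusions.\<close>
  have sub: "grundy ` options_of (a, b) \<subseteq> grundy ` options_of (b, a)"
    if IH: "\<And>c d. c + d < a + b \<Longrightarrow> grundy (c, d) = grundy (d, c)" for a b
  proof
    fix v assume "v \<in> grundy ` options_of (a, b)"
    then obtain c d where cd: "(c, d) \<in> options_of (a, b)" "v = grundy (c, d)" by auto
    then have "(d, c) \<in> options_of (b, a)" and "c + d < a + b"
      by (auto simp: options_of_def legal_def)
    then show "v \<in> grundy ` options_of (b, a)" using cd IH by (metis image_eqI)
  qed
  have "grundy ` options_of (a, b) = grundy ` options_of (b, a)"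
    using sub[of a b] sub[of b a] less by (metis add.commute subset_antisym)
  then show ?case by (metis grundy.simps)
qed

section \<open>Each value occurs exactly once in each row\<close>

text \<open>Of two legal positions in a row, the one with smaller second entry is an option of the
  other. Legality matters: the meaningless value at \<open>(0, 0)\<close> equals that at
  \<open>(0, 1)\<close>.\<close>

lemma grundy_row_inj:
  assumes "legal (x, y)" and "legal (x, y')" and "grundy (x, y) = grundy (x, y')"
  shows "y = y'"
proof (rule linorder_cases[of y y'])
  assume "y < y'"
  then have "(x, y) \<in> options_of (x, y')" using assms by (simp add: options_of_def)
  then show ?thesis using grundy_option_neq assms by metis
next
  assume "y' < y"
  then have "(x, y') \<in> options_of (x, y)" using assms by (simp add: options_of_def)
  then show ?thesis using grundy_option_neq assms by metis
qed

lemma finite_row_if_finite_values: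
  assumes "finite V"
  shows "finite {y. legal (x, y) \<and> grundy (x, y) \<in> V}"
proof (rule inj_on_finite)
  show "inj_on (\<lambda>y. grundy (x, y)) {y. legal (x, y) \<and> grundy (x, y) \<in> V}"
    by (rule inj_onI) (use grundy_row_inj in blast)
qed (use assms in auto)

text \<open>
  If g is missing in row x, then almost all positions of the row have a value above g and hence
  an option of value g in one of the finitely many rows below x; but each such row contains g at
  most once.
\<close>

lemma grundy_row_surj: "\<exists>y. legal (x, y) \<and> grundy (x, y) = g"
proof (rule ccontr)
  assume no: "\<not> ?thesis"
  let ?Y = "{y. legal (x, y) \<and> grundy (x, y) \<le> g}"
  let ?C = "\<Union>x'<x. {y. legal (x', y) \<and> grundy (x', y) = g}"
  have "finite ?Y" using finite_row_if_finite_values[of "{..g}" x] by (simp only: atMost_iff finite_atMost)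
  moreover have "finite ?C"
    using finite_row_if_finite_values[of "{g}"]
    by (intro finite_UN_I) (simp_all only: finite.intros finite_lessThan singleton_iff)
  \<comment> \<open>Excluding \<open>0\<close> makes \<open>(x, y)\<close> legal even in row
    0.\<close>
  ultimately have "finite (insert 0 (?Y \<union> ?C))" by (intro finite.insertI finite_UnI)
  then obtain y where y: "y \<notin> insert 0 (?Y \<union> ?C)"
    using ex_new_if_finite infinite_UNIV_nat by blast
  then have "legal (x, y)" by (simp add: legal_def)
  then have "g < grundy (x, y)" using y by simp
  then obtain q where q: "q \<in> options_of (x, y)" "grundy q = g"
    by (rule ex_option_of_less_grundy)
  obtain c d where cd: "q = (c, d)" by (cases q)
  have "c \<noteq> x" using q cd no by (auto simp: options_of_def)
  then have "c < x" "d = y" "legal (c, y)" using q cd by (auto simp: options_of_def)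
  then have "y \<in> ?C" using q cd by blast
  then show False using y by blast
qed

section \<open>The involution of a value and the enumeration of its pairs\<close>

definition partner :: "nat \<Rightarrow> nat \<Rightarrow> nat" where
  "partner g x = (THE y. legal (x, y) \<and> grundy (x, y) = g)"

lemma partner: "legal (x, partner g x)" "grundy (x, partner g x) = g"
proof -
  have "\<exists>!y. legal (x, y) \<and> grundy (x, y) = g"
    using grundy_row_surj grundy_row_inj by metis
  from theI'[OF this] show "legal (x, partner g x)" "grundy (x, partner g x) = g"
    by (simp_all add: partner_def)
qed

lemma partner_eqI: "legal (x, y) \<Longrightarrow> grundy (x, y) = g \<Longrightarrow> partner g x = y"
  using grundy_row_inj partner by metis

text \<open>By symmetry the swapped position also has value \<open>g\<close>, and row
  \<open>partner g x\<close> contains that value only once.\<close>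

lemma partner_partner [simp]: "partner g (partner g x) = x"
  using partner[of x g] by (auto intro!: partner_eqI simp: legal_def grundy_commute)

text \<open>Fixed points of \<open>partner g\<close> are included; they are the diagonal
  positions.\<close>

definition firsts :: "nat \<Rightarrow> nat set" where
  "firsts g = {x. x \<le> partner g x}"

lemma partner_mem_firsts: "x \<notin> firsts g \<Longrightarrow> partner g x \<in> firsts g"
  by (simp add: firsts_def)

text \<open>Every natural number lies in \<open>firsts g\<close> or is the partner of an element of
  it. Infinity is what makes \<open>enumerate\<close> total and strictly increasing on this
  set.\<close>

lemma infinite_firsts: "infinite (firsts g)"
proof
  assume fin: "finite (firsts g)"
  have "UNIV \<subseteq> firsts g \<union> partner g ` firsts g"
    using partner_mem_firsts by (metis Un_iff image_eqI partner_partner subsetI)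
  then show False using fin by (meson finite_Un finite_imageI infinite_UNIV_nat finite_subset)
qed

text \<open>An explicit candidate, with which both \<open>g_sequence\<close> and
  \<open>alg_sequence\<close> are compared.\<close>

definition pair_enum :: "nat \<Rightarrow> nat \<Rightarrow> nat \<times> nat" where
  "pair_enum g n = (enumerate (firsts g) n, partner g (enumerate (firsts g) n))"

lemma enumerate_firsts:
  shows "enumerate (firsts g) n \<in> firsts g"
    and "i < j \<Longrightarrow> enumerate (firsts g) i < enumerate (firsts g) j"
  by (simp_all add: enumerate_in_set enumerate_mono infinite_firsts)

lemma less_enumerate_firstsE:
  assumes "x \<in> firsts g" and "x < enumerate (firsts g) n"
  obtains i where "i < n" and "x = enumerate (firsts g) i"
  by (metis assms enumerate_Ex enumerate_mono_iff infinite_firsts that)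

lemma range_pair_enum: "range (pair_enum g) = positions_of_value g"
proof (intro equalityI subsetI)
  fix p assume "p \<in> range (pair_enum g)"
  then show "p \<in> positions_of_value g"
    using enumerate_firsts(1) partner
    by (auto simp: pair_enum_def positions_of_value_def firsts_def Let_def)
next
  fix p assume "p \<in> positions_of_value g"
  then obtain a b where p: "p = (a, b)" "a \<le> b" "partner g a = b"
    using partner_eqI by (auto simp: positions_of_value_def)
  then obtain n where "enumerate (firsts g) n = a"
    using enumerate_Ex[OF infinite_firsts, of a g] by (auto simp: firsts_def)
  then show "p \<in> range (pair_enum g)"
    using p by (auto simp: pair_enum_def intro!: image_eqI[of _ _ n])
qed

lemma is_g_sequence_pair_enum: "is_g_sequence g (pair_enum g)"
  by (simp add: is_g_sequence_def range_pair_enum) (simp add: pair_enum_def enumerate_firsts(2))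

text \<open>If the sequences agree before \<open>n\<close>, then term \<open>n\<close> of either one
  occurs in the other at an index at least \<open>n\<close>, so its first entry is at least as
  large. Hence the first entries agree, and strict monotonicity forces the same index.\<close>

lemma is_g_sequence_unique:
  assumes s: "is_g_sequence g s" and t: "is_g_sequence g t"
  shows "s = t"
proof
  fix n
  show "s n = t n"
  proof (induction n rule: less_induct)
    case (less n)
    have le: "fst (s n) \<le> fst (t n)"
      if s: "is_g_sequence g s" and t: "is_g_sequence g t" and eq: "\<And>m. m < n \<Longrightarrow> s m = t m"
      for s t
    proof -
      obtain j where j: "t n = s j" using s t by (metis is_g_sequence_def rangeE rangeI)
      have "\<not> j < n" using eq j t by (metis is_g_sequence_def less_irrefl)
      then show ?thesis using s j by (metis is_g_sequence_def le_less linorder_neqE_nat order_refl)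
    qed
    have fst: "fst (s n) = fst (t n)"
      by (rule antisym) (use le s t less in metis)+
    obtain j where j: "t n = s j" using s t by (metis is_g_sequence_def rangeE rangeI)
    then have "j = n" using fst s by (metis is_g_sequence_def less_irrefl linorder_neqE_nat)
    then show ?case using j by simp
  qed
qed

lemma g_sequence_eq: "g_sequence g = pair_enum g"
  unfolding g_sequence_def
  by (rule the_equality) (use is_g_sequence_pair_enum is_g_sequence_unique in blast)+

section \<open>The positions of value zero\<close>

text \<open>The value lags by one behind that of an ordinary Nim heap, because the move to
  \<open>(0, 0)\<close> is forbidden.\<close>

lemma grundy_0_Suc: "grundy (0, Suc n) = n"
proof (induction n rule: less_induct)
  case (less n)
  have opt: "options_of (0, Suc n) = (\<lambda>m. (0, Suc m)) ` {..<n}"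
    by (auto simp: options_of_def legal_def less_Suc_eq_0_disj)
  have "grundy ` options_of (0, Suc n) = {..<n}"
    unfolding opt image_image using less by simp
  then show ?case by (subst grundy.simps) (simp add: mex_eqI)
qed

text \<open>No option of \<open>(x, x)\<close> has value 0: up to order it is \<open>(a, x)\<close>
  with \<open>a < x\<close>. For \<open>a = 0\<close> its value is \<open>x - 1\<close>; for
  \<open>a = 1\<close> it can move to \<open>(1, 0)\<close>, and for larger \<open>a\<close> to
  \<open>(a, a)\<close>, both of value 0.\<close>

lemma grundy_diag:
  assumes "2 \<le> x"
  shows "grundy (x, x) = 0"
  using assms
proof (induction x rule: less_induct)
  case (less x)
  have pos: "grundy (a, x) \<noteq> 0" if "a < x" for a
  proof -
    consider "a = 0" | "a = 1" | "2 \<le> a" by linarith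
    then show ?thesis
    proof cases
      case 1
      moreover obtain n where "x = Suc n" "n \<noteq> 0" using less.prems by (cases x) auto
      ultimately show ?thesis using grundy_0_Suc[of n] by simp
    next
      case 2
      then have "(a, 0) \<in> options_of (a, x)"
        using less.prems by (simp add: options_of_def legal_def)
      moreover have "grundy (a, 0) = 0"
        using 2 grundy_0_Suc[of 0] grundy_commute[of a 0] by simp
      ultimately show ?thesis using grundy_option_neq[of "(a, 0)" "(a, x)"] by simp
    next
      case 3
      then have "(a, a) \<in> options_of (a, x)" using that by (simp add: options_of_def legal_def)
      then show ?thesis
        using grundy_option_neq[of "(a, a)" "(a, x)"] less.IH[OF that 3] by simp
    qed
  qed
  show ?case
  proof (rule ccontr)
    assume "grundy (x, x) \<noteq> 0"
    then obtain q where q: "q \<in> options_of (x, x)" "grundy q = 0"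
      using ex_option_of_less_grundy[of 0 "(x, x)"] by blast
    then obtain a where "a < x" "q = (a, x) \<or> q = (x, a)"
      by (cases q) (auto simp: options_of_def)
    then have "grundy (a, x) = 0" using q(2) grundy_commute[of a x] by metis
    then show False using pos[OF \<open>a < x\<close>] by contradiction
  qed
qed

text \<open>The involution for value 0 exchanges 0 and 1 and fixes all other numbers, which settles
  every row.\<close>

lemma positions_of_value_0: "positions_of_value 0 = insert (0, 1) {(x, x) | x. 2 \<le> x}"
proof -
  have p0: "partner 0 0 = 1"
    using grundy_0_Suc[of 0] by (intro partner_eqI) (auto simp: legal_def)
  then have p1: "partner 0 1 = 0" by (metis partner_partner)
  have px: "partner 0 x = x" if "2 \<le> x" for x
    using that by (intro partner_eqI grundy_diag) (auto simp: legal_def)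
  have "(a, b) \<in> positions_of_value 0 \<longleftrightarrow> (a, b) \<in> insert (0, 1) {(x, x) | x. 2 \<le> x}" for a b
  proof -
    have mem: "(a, b) \<in> positions_of_value 0 \<longleftrightarrow> a \<le> b \<and> partner 0 a = b"
      using partner[of a 0] partner_eqI[of a b 0] by (auto simp: positions_of_value_def)
    consider "a = 0" | "a = 1" | "2 \<le> a" by linarith
    then show ?thesis
    proof cases
      case 1
      then show ?thesis using p0 mem by auto
    next
      case 2
      then show ?thesis using p1 mem by auto
    next
      case 3
      then show ?thesis using px[OF 3] mem by auto
    qed
  qed
  then show ?thesis by (intro set_eqI) (simp only: split_paired_all)
qed

lemma is_g_sequence_alg_0: "is_g_sequence 0 (alg_sequence 0)"
proof -
  have alg: "alg_sequence 0 n = (if n = 0 then (0, 1) else (n + 1, n + 1))" for n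
    by (subst alg_sequence.simps) simp
  have "range (alg_sequence 0) = insert (0, 1) {(x, x) | x. 2 \<le> x}"
  proof (intro equalityI subsetI)
    fix p :: "nat \<times> nat" assume "p \<in> insert (0, 1) {(x, x) | x. 2 \<le> x}"
    \<comment> \<open>The term \<open>(x, x)\<close> has index \<open>x - 1\<close>, since 1 is not
      a first entry.\<close>
    then consider "p = alg_sequence 0 0" | x where "2 \<le> x" "p = alg_sequence 0 (x - 1)"
      by (auto simp: alg)
    then show "p \<in> range (alg_sequence 0)" by cases auto
  qed (auto simp: alg)
  then show ?thesis by (simp add: is_g_sequence_def positions_of_value_0 alg)
qed

section \<open>Correctness of the two steps of the algorithm\<close>

text \<open>An element of \<open>firsts g\<close> cannot be the partner of a smaller number.
  Conversely, a number below \<open>enumerate (firsts g) n\<close> is an earlier first entry, or its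
  partner is a still smaller element of \<open>firsts g\<close>, which makes it an earlier second
  entry.\<close>

lemma mex_pair_enum:
  "mex (fst ` pair_enum g ` {..<n} \<union> snd ` pair_enum g ` {..<n}) = enumerate (firsts g) n"
proof (rule mex_eqI)
  let ?e = "enumerate (firsts g)"
  have "?e n \<noteq> partner g (?e i)" if "i < n" for i
  proof
    assume "?e n = partner g (?e i)"
    then have "partner g (?e n) = ?e i" by simp
    moreover have "?e n \<le> partner g (?e n)"
      using enumerate_firsts(1)[of g n] by (simp add: firsts_def)
    ultimately show False using enumerate_firsts(2)[OF that, of g] by simp
  qed
  then show "?e n \<notin> fst ` pair_enum g ` {..<n} \<union> snd ` pair_enum g ` {..<n}"
    using enumerate_firsts(2)[of _ n g] by (fastforce simp: pair_enum_def)
next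
  let ?e = "enumerate (firsts g)"
  fix m assume m: "m < ?e n"
  show "m \<in> fst ` pair_enum g ` {..<n} \<union> snd ` pair_enum g ` {..<n}"
  proof (cases "m \<in> firsts g")
    case True
    then show ?thesis
      using m by (auto simp: pair_enum_def image_image elim!: less_enumerate_firstsE)
  next
    case False
    then have "partner g m < ?e n" using m by (simp add: firsts_def)
    then obtain i where i: "i < n" "partner g m = ?e i"
      using partner_mem_firsts[OF False] by (auto elim: less_enumerate_firstsE)
    then have "m = partner g (?e i)" by (metis partner_partner)
    then show ?thesis using i by (auto simp: pair_enum_def image_image)
  qed
qed

text \<open>This is the search of the algorithm, with the earlier terms and the lower sequences
  already identified. The difference is not truncated, as \<open>x\<close> lies in
  \<open>firsts g\<close>.\<close>

lemma search_partner:
  fixes g n :: nat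
  defines "x \<equiv> enumerate (firsts g) n"
  shows "(LEAST z. legal (x, x + z) \<and> x + z \<notin> snd ` pair_enum g ` {..<n} \<and>
            (\<forall>k<g. (x, x + z) \<notin> positions_of_value k)) = partner g x - x"
proof (rule Least_equality)
  have xf: "x \<le> partner g x" using enumerate_firsts(1) by (auto simp: x_def firsts_def)
  have ne: "partner g (enumerate (firsts g) i) \<noteq> partner g x" if "i < n" for i
    using enumerate_firsts(2)[OF that, of g] by (metis partner_partner x_def less_irrefl)
  have "partner g x \<notin> snd ` pair_enum g ` {..<n}"
  proof
    assume "partner g x \<in> snd ` pair_enum g ` {..<n}"
    then obtain i where "i < n" "partner g x = partner g (enumerate (firsts g) i)"
      by (auto simp only: pair_enum_def image_image snd_conv image_iff lessThan_iff)
    then show False using ne by metis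
  qed
  moreover have "(x, partner g x) \<notin> positions_of_value k" if "k < g" for k
    using that partner(2)[of x g] unfolding positions_of_value_def by force
  ultimately show "legal (x, x + (partner g x - x)) \<and>
      x + (partner g x - x) \<notin> snd ` pair_enum g ` {..<n} \<and>
      (\<forall>k<g. (x, x + (partner g x - x)) \<notin> positions_of_value k)"
    using partner(1) unfolding le_add_diff_inverse[OF xf] by blast
next
  fix z
  assume z: "legal (x, x + z) \<and> x + z \<notin> snd ` pair_enum g ` {..<n} \<and>
    (\<forall>k<g. (x, x + z) \<notin> positions_of_value k)"
  show "partner g x - x \<le> z"
  proof (rule ccontr)
    assume "\<not> ?thesis"
    then have less: "x + z < partner g x" by simp
    have "\<not> grundy (x, x + z) < g"
      using z unfolding positions_of_value_def by (metis (mono_tags, lifting) case_prodI le_add1 mem_Collect_eq)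
    moreover have "grundy (x, x + z) \<noteq> g"
    proof
      assume "grundy (x, x + z) = g"
      then have "partner g x = x + z" using z by (intro partner_eqI) simp_all
      then show False using less by simp
    qed
    ultimately have "g < grundy (x, x + z)" by simp
    then obtain q where q: "q \<in> options_of (x, x + z)" "grundy q = g"
      by (rule ex_option_of_less_grundy)
    obtain c d where cd: "q = (c, d)" by (cases q)
    have pc: "partner g c = d"
      using q unfolding cd by (intro partner_eqI) (simp_all add: options_of_def)
    have "c < x \<and> d = x + z \<or> c = x \<and> d < x + z"
      using q(1) unfolding cd options_of_def by simp
    \<comment> \<open>An option in row \<open>x\<close> would make \<open>d\<close> the partner of
      \<open>x\<close>, although \<open>d\<close> is below it.\<close>
    then have c: "c < x" "d = x + z" using pc less by auto
    \<comment> \<open>Here \<open>c < x \<le> x + z = partner g c\<close>.\<close>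
    then have "c \<in> firsts g" using pc by (simp add: firsts_def)
    then obtain i where i: "i < n" "c = enumerate (firsts g) i"
      using c(1) unfolding x_def by (rule less_enumerate_firstsE)
    then have "x + z = snd (pair_enum g i)" using pc c by (simp add: pair_enum_def)
    then have "x + z \<in> snd ` pair_enum g ` {..<n}" using i(1) by blast
    then show False using z by blast
  qed
qed

text \<open>The outer induction on \<open>g\<close> identifies the lower sequences, the inner one on
  \<open>n\<close> the earlier terms. The explicitly given sequence for \<open>g = 0\<close> is
  handled by uniqueness instead.\<close>

lemma alg_sequence_eq: "alg_sequence g n = pair_enum g n"
proof (induction g arbitrary: n rule: less_induct)
  case (less g)
  show ?case
  proof (cases "g = 0")
    case True
    then show ?thesis
      using is_g_sequence_unique[OF is_g_sequence_alg_0 is_g_sequence_pair_enum] by metis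
  next
    case False
    have lower: "range (alg_sequence k) = positions_of_value k" if "k < g" for k
      using less[OF that] range_pair_enum by (metis ext)
    show ?thesis
    proof (induction n rule: less_induct)
      case (less n)
      let ?x = "enumerate (firsts g) n"
      have prev: "alg_sequence g ` {..<n} = pair_enum g ` {..<n}" using less by simp
      have le: "?x \<le> partner g ?x" using enumerate_firsts(1) by (auto simp: firsts_def)
      have "alg_sequence g n =
          (?x, ?x + (LEAST z. legal (?x, ?x + z) \<and> ?x + z \<notin> snd ` pair_enum g ` {..<n} \<and>
            (\<forall>k<g. (?x, ?x + z) \<notin> positions_of_value k)))"
        using False lower
        by (subst alg_sequence.simps) (simp add: Let_def prev mex_pair_enum cong: conj_cong)
      also have "\<dots> = pair_enum g n"
        unfolding search_partner using le by (simp add: pair_enum_def)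
      finally show ?case .
    qed
  qed
qed

theorem theorem3:
  fixes g :: nat
  assumes "g \<ge> 1"
  shows "is_g_sequence g (g_sequence g) \<and>
         (\<forall>n. alg_sequence g n = g_sequence g n)"
  by (simp add: g_sequence_eq is_g_sequence_pair_enum alg_sequence_eq)

end
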